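(* Let $\mathbf A$ be an MV-algebra, $t:\mathbf A\to[0,1]$ a semi-state on $\mathbf A$, and $$S_t=\{s:\mathbf A\to[0,1]\mid s \text{ is an MV-morphism},\ s\ge t\},$$ where $s\ge t$ is meant pointwise and $[0,1]$ is the standard MV-algebra. Then $t=\bigwedge S_t$ (pointwise infimum).
   Context: An MV-algebra $(A,\oplus,\neg,0)$ has $1=\neg 0$, $x\odot y=\neg(\neg x\oplus\neg y)$, and order $x\le y$ iff $\neg x\oplus y=1$. The standard MV-algebra is $[0,1]$ with $a\oplus b=\min(1,a+b)$, $\neg a=1-a$ (so $a\odot b=\max(0,a+b-1)$). An MV-morphism is a map preserving $\oplus,\odot,\neg,0,1$. A map $s:\mathbf A\to[0,1]$ is a semi-state on $\mathbf A$ if for all $x,y\in A$: (i) $s(1)=1$; (ii) $x\le y$ implies $s(x)\le s(y)$; (iii) $s(x)=1$ and $s(y)=1$ implies $s(x\odot y)=1$; (iv) $s(x)\odot s(x)=s(x\odot x)$; (v) $s(x)\oplus s(x)=s(x\oplus x)$. Infima are taken in $[0,1]$, so the infimum of the empty set is $1$. *)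

theory Defs
  imports Complex_Main "HOL-Algebra.Congruence"
begin

record 'a mv_algebra = "'a partial_object" +
  mv_plus :: "'a \<Rightarrow> 'a \<Rightarrow> 'a"  (infixl \<open>\<oplus>\<index>\<close> 65)
  mv_neg :: "'a \<Rightarrow> 'a"  (\<open>\<sim>\<index> _\<close> [81] 80)
  mv_zero :: 'a  (\<open>\<zero>\<index>\<close>)

definition mv_one :: "('a, 'b) mv_algebra_scheme \<Rightarrow> 'a"  (\<open>\<one>\<index>\<close>)
  where "\<one>\<^bsub>A\<^esub> = \<sim>\<^bsub>A\<^esub> \<zero>\<^bsub>A\<^esub>"

definition mv_times :: "('a, 'b) mv_algebra_scheme \<Rightarrow> 'a \<Rightarrow> 'a \<Rightarrow> 'a"  (infixl \<open>\<odot>\<index>\<close> 70)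
  where "x \<odot>\<^bsub>A\<^esub> y = \<sim>\<^bsub>A\<^esub> (\<sim>\<^bsub>A\<^esub> x \<oplus>\<^bsub>A\<^esub> \<sim>\<^bsub>A\<^esub> y)"

definition mv_le :: "('a, 'b) mv_algebra_scheme \<Rightarrow> 'a \<Rightarrow> 'a \<Rightarrow> bool"  (infix \<open>\<preceq>\<index>\<close> 50)
  where "x \<preceq>\<^bsub>A\<^esub> y \<longleftrightarrow> \<sim>\<^bsub>A\<^esub> x \<oplus>\<^bsub>A\<^esub> y = \<one>\<^bsub>A\<^esub>"

locale mv_algebra =
  fixes A (structure)
  assumes plus_closed: "\<lbrakk>x \<in> carrier A; y \<in> carrier A\<rbrakk> \<Longrightarrow> x \<oplus> y \<in> carrier A"
    and neg_closed: "x \<in> carrier A \<Longrightarrow> \<sim> x \<in> carrier A"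
    and zero_closed: "\<zero> \<in> carrier A"
    and plus_assoc: "\<lbrakk>x \<in> carrier A; y \<in> carrier A; z \<in> carrier A\<rbrakk> \<Longrightarrow>
      (x \<oplus> y) \<oplus> z = x \<oplus> (y \<oplus> z)"
    and plus_comm: "\<lbrakk>x \<in> carrier A; y \<in> carrier A\<rbrakk> \<Longrightarrow> x \<oplus> y = y \<oplus> x"
    and plus_zero: "x \<in> carrier A \<Longrightarrow> x \<oplus> \<zero> = x"
    and neg_neg: "x \<in> carrier A \<Longrightarrow> \<sim> (\<sim> x) = x"
    and plus_one: "x \<in> carrier A \<Longrightarrow> x \<oplus> \<sim> \<zero> = \<sim> \<zero>"
    and lukasiewicz: "\<lbrakk>x \<in> carrier A; y \<in> carrier A\<rbrakk> \<Longrightarrow>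
      \<sim> (\<sim> x \<oplus> y) \<oplus> y = \<sim> (\<sim> y \<oplus> x) \<oplus> x"

definition mv_hom ::
    "('a, 'c) mv_algebra_scheme \<Rightarrow> ('b, 'd) mv_algebra_scheme \<Rightarrow> ('a \<Rightarrow> 'b) set"
  where "mv_hom A B = {h \<in> carrier A \<rightarrow> carrier B.
    (\<forall>x\<in>carrier A. \<forall>y\<in>carrier A. h (x \<oplus>\<^bsub>A\<^esub> y) = h x \<oplus>\<^bsub>B\<^esub> h y) \<and>
    (\<forall>x\<in>carrier A. \<forall>y\<in>carrier A. h (x \<odot>\<^bsub>A\<^esub> y) = h x \<odot>\<^bsub>B\<^esub> h y) \<and>
    (\<forall>x\<in>carrier A. h (\<sim>\<^bsub>A\<^esub> x) = \<sim>\<^bsub>B\<^esub> h x) \<and>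
    h \<zero>\<^bsub>A\<^esub> = \<zero>\<^bsub>B\<^esub> \<and> h \<one>\<^bsub>A\<^esub> = \<one>\<^bsub>B\<^esub>}"

definition standard_mv :: "real mv_algebra"
  where "standard_mv =
    \<lparr>carrier = {0..1}, mv_plus = (\<lambda>a b. min 1 (a + b)), mv_neg = (\<lambda>a. 1 - a), mv_zero = 0\<rparr>"

lemma standard_mv_simps [simp]:
  "carrier standard_mv = {0..1}"
  "a \<oplus>\<^bsub>standard_mv\<^esub> b = min 1 (a + b)"
  "\<sim>\<^bsub>standard_mv\<^esub> a = 1 - a"
  "\<zero>\<^bsub>standard_mv\<^esub> = 0"
  "\<one>\<^bsub>standard_mv\<^esub> = 1"
  "a \<odot>\<^bsub>standard_mv\<^esub> b = max 0 (a + b - 1)"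
  "a \<preceq>\<^bsub>standard_mv\<^esub> b \<longleftrightarrow> a \<le> b"
  by (auto simp: standard_mv_def mv_one_def mv_times_def mv_le_def min_def max_def)

lemma mv_algebra_standard_mv: "mv_algebra standard_mv"
  by unfold_locales (auto simp: min_def)

definition semi_state :: "('a, 'b) mv_algebra_scheme \<Rightarrow> ('a \<Rightarrow> real) \<Rightarrow> bool"
  where "semi_state A s \<longleftrightarrow>
    s \<in> carrier A \<rightarrow> {0..1} \<and>
    s \<one>\<^bsub>A\<^esub> = 1 \<and>
    (\<forall>x\<in>carrier A. \<forall>y\<in>carrier A. x \<preceq>\<^bsub>A\<^esub> y \<longrightarrow> s x \<le> s y) \<and>
    (\<forall>x\<in>carrier A. \<forall>y\<in>carrier A. s x = 1 \<and> s y = 1 \<longrightarrow> s (x \<odot>\<^bsub>A\<^esub> y) = 1) \<and>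
    (\<forall>x\<in>carrier A. s x \<odot>\<^bsub>standard_mv\<^esub> s x = s (x \<odot>\<^bsub>A\<^esub> x)) \<and>
    (\<forall>x\<in>carrier A. s x \<oplus>\<^bsub>standard_mv\<^esub> s x = s (x \<oplus>\<^bsub>A\<^esub> x))"

definition mv_morphisms_above ::
    "('a, 'b) mv_algebra_scheme \<Rightarrow> ('a \<Rightarrow> real) \<Rightarrow> ('a \<Rightarrow> real) set"
  where "mv_morphisms_above A t = {s \<in> mv_hom A standard_mv. \<forall>x\<in>carrier A. t x \<le> s x}"

text \<open>The infimum of a subset of the unit interval, taken in the unit interval. Inserting 1
  only affects the empty set, whose infimum in the type of reals is unspecified.\<close>

definition unit_Inf :: "real set \<Rightarrow> real"
  where "unit_Inf X = Inf (insert 1 X)"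

lemma unit_Inf_eq_iff:
  assumes "X \<subseteq> {0..1}"
  shows "z = unit_Inf X \<longleftrightarrow>
    z \<in> {0..1} \<and> (\<forall>x\<in>X. z \<le> x) \<and> (\<forall>w\<in>{0..1}. (\<forall>x\<in>X. w \<le> x) \<longrightarrow> w \<le> z)"
proof -
  have bdd: "bdd_below (insert 1 X)"
    using assms by (intro bdd_belowI[of _ 0]) auto
  have lower: "unit_Inf X \<le> x" if "x \<in> insert 1 X" for x
    unfolding unit_Inf_def using that bdd by (rule cInf_lower)
  have greatest: "w \<le> unit_Inf X" if "w \<le> 1" "\<forall>x\<in>X. w \<le> x" for w
    unfolding unit_Inf_def using that by (intro cInf_greatest) auto
  have "0 \<le> unit_Inf X"
    using assms by (intro greatest) auto
  moreover have "unit_Inf X \<le> 1"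
    by (rule lower) simp
  ultimately have "unit_Inf X \<in> {0..1}" by simp
  with lower greatest show ?thesis
    by (auto intro!: antisym)
qed

end

theory Submission
  imports Defs
begin

text \<open>
A semi-state \<open>t\<close> is determined by the filter \<open>F\<close> of the elements at which it takes the value 1. The
reason is that for every dyadic number \<open>d\<close> in \<open>(0, 1]\<close> some term built from \<open>x \<oplus> x\<close> and
\<open>x \<odot> x\<close> takes the value 1 at a real \<open>a\<close> in the unit interval precisely if \<open>d \<le> a\<close>. Semi-states
preserve these threshold terms, so \<open>d \<le> t x\<close> holds if and only if the threshold of \<open>x\<close> at \<open>d\<close> lies
in \<open>F\<close>. Since morphisms preserve thresholds as well, any morphism with value 1 on \<open>F\<close> is
pointwise above \<open>t\<close>.

It remains to find, whenever \<open>t x < d\<close>, a morphism that is 1 on \<open>F\<close> and at most \<open>d\<close> at \<open>x\<close>.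
The threshold \<open>z\<close> of \<open>x\<close> at \<open>d\<close> is not in \<open>F\<close>, and a filter that is maximal among those
containing \<open>F\<close> but not \<open>z\<close> is prime, so its quotient is a chain in which the image of \<open>z\<close> is not
\<open>\<one>\<close> (\<open>filter_separation_by_chain\<close>). Every chain has a morphism into the unit interval that reads
off binary digits: the leading digit of \<open>x\<close> tells whether \<open>x \<oplus> x = \<one>\<close>, and the remaining ones are
those of \<open>x \<odot> x\<close> or \<open>x \<oplus> x\<close>. That it is additive follows by contraction: removing
leading digits halves the deviation from additivity, which is bounded and hence zero
(\<open>expansion_plus_disjoint\<close>). An element whose expansion exceeds \<open>d\<close> passes the threshold at \<open>d\<close>
even if the chain has infinitesimals (\<open>threshold_of_expansion\<close>). Hence the composed morphism has
value at most \<open>d\<close> at \<open>x\<close>.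
\<close>

section \<open>Arithmetic and order of MV-algebras\<close>

context mv_algebra
begin

lemma one_closed [simp]: "\<one> \<in> carrier A"
  by (simp add: mv_one_def neg_closed zero_closed)

lemmas closed [simp] = plus_closed neg_closed zero_closed

lemma times_closed [simp]: "x \<in> carrier A \<Longrightarrow> y \<in> carrier A \<Longrightarrow> x \<odot> y \<in> carrier A"
  by (simp add: mv_times_def)

lemmas [simp] = neg_neg plus_zero

lemma neg_zero [simp]: "\<sim> \<zero> = \<one>"
  by (simp add: mv_one_def)

lemma neg_one [simp]: "\<sim> \<one> = \<zero>"
  using neg_neg[OF zero_closed] by simp

lemma plus_left_comm:
  "x \<in> carrier A \<Longrightarrow> y \<in> carrier A \<Longrightarrow> z \<in> carrier A \<Longrightarrow> x \<oplus> (y \<oplus> z) = y \<oplus> (x \<oplus> z)"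
  by (metis plus_assoc plus_comm)

lemmas plus_ac = plus_assoc plus_comm plus_left_comm

lemma zero_plus [simp]: "x \<in> carrier A \<Longrightarrow> \<zero> \<oplus> x = x"
  by (simp add: plus_comm[of \<zero>])

lemma plus_one_right [simp]: "x \<in> carrier A \<Longrightarrow> x \<oplus> \<one> = \<one>"
  using plus_one by simp

lemma plus_one_left [simp]: "x \<in> carrier A \<Longrightarrow> \<one> \<oplus> x = \<one>"
  by (simp add: plus_comm[of \<one>])

lemma neg_plus_self [simp]: "x \<in> carrier A \<Longrightarrow> \<sim> x \<oplus> x = \<one>"
  using lukasiewicz[of x \<one>] by simp

lemma plus_neg_self [simp]: "x \<in> carrier A \<Longrightarrow> x \<oplus> \<sim> x = \<one>"
  using neg_plus_self[of "\<sim> x"] by simp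

lemma neg_plus: "x \<in> carrier A \<Longrightarrow> y \<in> carrier A \<Longrightarrow> \<sim> (x \<oplus> y) = \<sim> x \<odot> \<sim> y"
  by (simp add: mv_times_def)

lemma neg_times: "x \<in> carrier A \<Longrightarrow> y \<in> carrier A \<Longrightarrow> \<sim> (x \<odot> y) = \<sim> x \<oplus> \<sim> y"
  by (simp add: mv_times_def)

lemma times_comm: "x \<in> carrier A \<Longrightarrow> y \<in> carrier A \<Longrightarrow> x \<odot> y = y \<odot> x"
  by (simp add: mv_times_def plus_comm)

lemma times_assoc:
  "x \<in> carrier A \<Longrightarrow> y \<in> carrier A \<Longrightarrow> z \<in> carrier A \<Longrightarrow> (x \<odot> y) \<odot> z = x \<odot> (y \<odot> z)"
  by (simp add: mv_times_def plus_assoc)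

lemma times_one [simp]:
  "x \<in> carrier A \<Longrightarrow> x \<odot> \<one> = x"
  "x \<in> carrier A \<Longrightarrow> \<one> \<odot> x = x"
  by (simp_all add: mv_times_def)

lemma times_zero [simp]:
  "x \<in> carrier A \<Longrightarrow> x \<odot> \<zero> = \<zero>"
  "x \<in> carrier A \<Longrightarrow> \<zero> \<odot> x = \<zero>"
  by (simp_all add: mv_times_def)

lemma times_neg_self [simp]:
  "x \<in> carrier A \<Longrightarrow> x \<odot> \<sim> x = \<zero>"
  "x \<in> carrier A \<Longrightarrow> \<sim> x \<odot> x = \<zero>"
  by (simp_all add: mv_times_def)

lemma le_iff_times_zero:
  assumes "x \<in> carrier A" "y \<in> carrier A"
  shows "x \<preceq> y \<longleftrightarrow> x \<odot> \<sim> y = \<zero>"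
  unfolding mv_le_def mv_times_def using assms
  by (metis closed(2) closed(1) neg_neg neg_one neg_zero)

lemma le_refl [simp]: "x \<in> carrier A \<Longrightarrow> x \<preceq> x"
  by (simp add: mv_le_def)

lemma zero_le [simp]: "x \<in> carrier A \<Longrightarrow> \<zero> \<preceq> x"
  by (simp add: mv_le_def)

lemma le_one [simp]: "x \<in> carrier A \<Longrightarrow> x \<preceq> \<one>"
  by (simp add: mv_le_def)

lemma le_plus [simp]:
  assumes "x \<in> carrier A" "y \<in> carrier A"
  shows "x \<preceq> x \<oplus> y" "x \<preceq> y \<oplus> x"
proof -
  show "x \<preceq> x \<oplus> y"
    using assms by (simp add: mv_le_def flip: plus_assoc)
  then show "x \<preceq> y \<oplus> x"
    using assms by (simp add: plus_comm)
qed

text \<open>The terms \<open>(x \<odot> \<sim> y) \<oplus> y\<close> below are the suprema of the lattice order: the Lukasiewicz axiom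
says that the construction is symmetric, and \<open>sup_upper\<close> and \<open>sup_least\<close> identify it.\<close>

lemma sup_commute:
  "x \<in> carrier A \<Longrightarrow> y \<in> carrier A \<Longrightarrow> (x \<odot> \<sim> y) \<oplus> y = (y \<odot> \<sim> x) \<oplus> x"
  using lukasiewicz[of x y] by (simp add: mv_times_def)

lemma diff_plus_cancel:
  assumes "x \<in> carrier A" "y \<in> carrier A" "x \<preceq> y"
  shows "(y \<odot> \<sim> x) \<oplus> x = y"
  using sup_commute[of x y] le_iff_times_zero[of x y] assms by simp

lemma le_antisym: "x \<in> carrier A \<Longrightarrow> y \<in> carrier A \<Longrightarrow> x \<preceq> y \<Longrightarrow> y \<preceq> x \<Longrightarrow> x = y"
  using diff_plus_cancel[of x y] le_iff_times_zero[of y x] by simp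

lemma le_trans:
  assumes "x \<in> carrier A" "y \<in> carrier A" "z \<in> carrier A" "x \<preceq> y" "y \<preceq> z"
  shows "x \<preceq> z"
proof -
  have "z = ((z \<odot> \<sim> y) \<oplus> (y \<odot> \<sim> x)) \<oplus> x"
    using assms diff_plus_cancel[of x y] diff_plus_cancel[of y z] by (simp add: plus_assoc)
  then show ?thesis
    using assms le_plus(2)[of x "(z \<odot> \<sim> y) \<oplus> (y \<odot> \<sim> x)"] by simp
qed

lemma neg_le_neg_iff [simp]:
  "x \<in> carrier A \<Longrightarrow> y \<in> carrier A \<Longrightarrow> \<sim> x \<preceq> \<sim> y \<longleftrightarrow> y \<preceq> x"
  by (simp add: mv_le_def plus_comm)

lemma le_neg_commute: "x \<in> carrier A \<Longrightarrow> y \<in> carrier A \<Longrightarrow> x \<preceq> \<sim> y \<longleftrightarrow> y \<preceq> \<sim> x"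
  using neg_le_neg_iff[of "\<sim> x" y] by simp

lemma neg_le_iff: "x \<in> carrier A \<Longrightarrow> y \<in> carrier A \<Longrightarrow> \<sim> x \<preceq> y \<longleftrightarrow> x \<oplus> y = \<one>"
  by (simp add: mv_le_def)

lemma one_le_iff: "x \<in> carrier A \<Longrightarrow> \<one> \<preceq> x \<longleftrightarrow> x = \<one>"
  by (simp add: mv_le_def)

lemma plus_mono:
  assumes "x \<in> carrier A" "y \<in> carrier A" "u \<in> carrier A" "v \<in> carrier A" "x \<preceq> u" "y \<preceq> v"
  shows "x \<oplus> y \<preceq> u \<oplus> v"
proof -
  have "u \<oplus> v = ((u \<odot> \<sim> x) \<oplus> x) \<oplus> ((v \<odot> \<sim> y) \<oplus> y)"
    using assms by (simp add: diff_plus_cancel)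
  also have "\<dots> = (x \<oplus> y) \<oplus> ((u \<odot> \<sim> x) \<oplus> (v \<odot> \<sim> y))"
    using assms by (simp add: plus_ac)
  finally show ?thesis
    using assms le_plus(1)[of "x \<oplus> y" "(u \<odot> \<sim> x) \<oplus> (v \<odot> \<sim> y)"] by simp
qed

lemma times_mono:
  assumes "x \<in> carrier A" "y \<in> carrier A" "u \<in> carrier A" "v \<in> carrier A" "x \<preceq> u" "y \<preceq> v"
  shows "x \<odot> y \<preceq> u \<odot> v"
  unfolding mv_times_def using assms by (simp add: plus_mono)

lemma times_le [simp]:
  assumes "x \<in> carrier A" "y \<in> carrier A"
  shows "x \<odot> y \<preceq> x" "y \<odot> x \<preceq> x"
  using assms times_mono[of x y x \<one>] times_mono[of y x \<one> x] by simp_all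

lemma residuation:
  "x \<in> carrier A \<Longrightarrow> y \<in> carrier A \<Longrightarrow> z \<in> carrier A \<Longrightarrow> x \<odot> y \<preceq> z \<longleftrightarrow> x \<preceq> \<sim> y \<oplus> z"
  by (simp add: mv_le_def neg_times plus_assoc)

lemma sup_upper:
  assumes "x \<in> carrier A" "y \<in> carrier A"
  shows "x \<preceq> (x \<odot> \<sim> y) \<oplus> y" "y \<preceq> (x \<odot> \<sim> y) \<oplus> y"
  by (simp add: assms sup_commute[of x y]) (simp add: assms)

lemma sup_least:
  assumes "x \<in> carrier A" "y \<in> carrier A" "z \<in> carrier A" "x \<preceq> z" "y \<preceq> z"
  shows "(x \<odot> \<sim> y) \<oplus> y \<preceq> z"
proof -
  have "(x \<odot> \<sim> y) \<oplus> y \<preceq> (z \<odot> \<sim> y) \<oplus> y"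
    using assms by (intro plus_mono times_mono) simp_all
  then show ?thesis
    using assms by (simp add: diff_plus_cancel)
qed

lemma plus_diff_cancel:
  assumes "x \<in> carrier A" "y \<in> carrier A" "y \<preceq> \<sim> x"
  shows "(x \<oplus> y) \<odot> \<sim> x = y"
proof -
  have "(\<sim> y \<odot> \<sim> x) \<oplus> x = \<sim> y"
    using assms by (intro diff_plus_cancel) (simp_all add: le_neg_commute)
  then have "\<sim> ((\<sim> y \<odot> \<sim> x) \<oplus> x) = y"
    using assms by simp
  then show ?thesis
    using assms by (simp add: neg_plus neg_times plus_comm times_comm)
qed

text \<open>The two implications between \<open>x\<close> and \<open>y\<close> have supremum \<open>\<one>\<close>. This is the law that makes
quotients by suitable filters linearly ordered. Dually, an element \<open>m\<close> below both truncated
differences \<open>x \<odot> \<sim> y\<close> and \<open>y \<odot> \<sim> x\<close> could be added to the infimum of \<open>x\<close> and \<open>y\<close> while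
staying below both.\<close>

lemma prelinear:
  assumes "x \<in> carrier A" "y \<in> carrier A" "w \<in> carrier A"
    and "\<sim> x \<oplus> y \<preceq> w" "\<sim> y \<oplus> x \<preceq> w"
  shows "w = \<one>"
proof -
  define m where "m = \<sim> w"
  define z where "z = x \<odot> (\<sim> x \<oplus> y)"
  have [simp]: "m \<in> carrier A" "z \<in> carrier A"
    using assms by (simp_all add: m_def z_def)
  have zx: "z \<preceq> x" and zy: "z \<preceq> y"
    using assms by (simp_all add: z_def times_comm[of x] residuation)
  have *: "z \<oplus> m \<preceq> a" if "a \<in> carrier A" "b \<in> carrier A" "z \<preceq> a" "z \<preceq> b" "\<sim> a \<oplus> b \<preceq> w" for a b
  proof -
    have "m \<preceq> a \<odot> \<sim> b"
      using that assms neg_le_neg_iff[of w "\<sim> a \<oplus> b"] by (simp add: m_def neg_plus)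
    moreover have "a \<odot> \<sim> b \<preceq> a \<odot> \<sim> z"
      using that by (intro times_mono) simp_all
    ultimately have "m \<preceq> a \<odot> \<sim> z"
      using that le_trans[of m "a \<odot> \<sim> b" "a \<odot> \<sim> z"] by simp
    then have "z \<oplus> m \<preceq> z \<oplus> (a \<odot> \<sim> z)"
      using that by (intro plus_mono) simp_all
    then show ?thesis
      using that diff_plus_cancel[of z a] by (simp add: plus_comm[of z])
  qed
  have le_x: "z \<oplus> m \<preceq> x" and le_y: "z \<oplus> m \<preceq> y"
    using *[of x y] *[of y x] assms zx zy by simp_all
  have "m \<preceq> x \<odot> \<sim> y"
    using assms neg_le_neg_iff[of w "\<sim> x \<oplus> y"] by (simp add: m_def neg_plus)
  moreover have "x \<odot> \<sim> y \<preceq> \<sim> z"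
    using zy assms le_trans[of "x \<odot> \<sim> y" "\<sim> y" "\<sim> z"] by simp
  ultimately have mz: "m \<preceq> \<sim> z"
    using assms le_trans[of m "x \<odot> \<sim> y" "\<sim> z"] by simp
  \<comment> \<open>The element \<open>z\<close> is the greatest lower bound of \<open>x\<close> and \<open>y\<close>, so \<open>z \<oplus> m\<close>
    cannot exceed it; as nothing is truncated in \<open>z \<oplus> m\<close>, this forces \<open>m = \<zero>\<close>.\<close>
  have "\<sim> z = (\<sim> y \<odot> \<sim> (\<sim> x)) \<oplus> \<sim> x"
    using assms by (simp add: z_def neg_times neg_plus plus_comm times_comm)
  then have "\<sim> z \<preceq> \<sim> (z \<oplus> m)"
    using sup_least[of "\<sim> y" "\<sim> x" "\<sim> (z \<oplus> m)"] le_x le_y assms by simp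
  then have "z \<oplus> m \<preceq> z" by simp
  then have "(z \<oplus> m) \<odot> \<sim> z = \<zero>"
    by (simp add: le_iff_times_zero)
  then have "m = \<zero>"
    using plus_diff_cancel[of z m] mz by simp
  then show ?thesis
    using assms by (metis m_def neg_neg neg_zero)
qed

text \<open>In the reals this is \<open>(x + y) - v = x + (y - v)\<close>; the hypotheses guarantee that neither the
sum nor the inner difference is truncated.\<close>

lemma plus_diff_assoc:
  assumes "x \<in> carrier A" "y \<in> carrier A" "v \<in> carrier A" "v \<preceq> y" "x \<preceq> \<sim> y"
  shows "(x \<oplus> y) \<odot> \<sim> v = x \<oplus> (y \<odot> \<sim> v)"
proof -
  define d where "d = y \<odot> \<sim> v"
  have [simp]: "d \<in> carrier A" using assms by (simp add: d_def)
  have y: "y = d \<oplus> v"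
    using assms by (simp add: d_def diff_plus_cancel)
  have dv: "d \<preceq> \<sim> v"
    using assms by (simp add: d_def)
  have "x \<preceq> \<sim> v \<odot> \<sim> d"
    using assms by (simp add: y neg_plus times_comm)
  then have "x \<oplus> d \<preceq> (\<sim> v \<odot> \<sim> d) \<oplus> d"
    using assms by (intro plus_mono) simp_all
  also have "(\<sim> v \<odot> \<sim> d) \<oplus> d = \<sim> v"
    using assms dv by (simp add: diff_plus_cancel)
  finally have "(v \<oplus> (x \<oplus> d)) \<odot> \<sim> v = x \<oplus> d"
    using assms by (intro plus_diff_cancel) simp_all
  moreover have "x \<oplus> y = v \<oplus> (x \<oplus> d)"
    using assms by (simp add: y plus_ac)
  ultimately show ?thesis
    by (simp add: d_def)
qed

lemma times_plus_self:
  assumes "x \<in> carrier A" "y \<in> carrier A" "x \<preceq> \<sim> y" "\<sim> y \<preceq> y"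
  shows "y \<odot> (x \<oplus> y) = x \<oplus> (y \<odot> y)"
  using plus_diff_assoc[of x y "\<sim> y"] assms by (simp add: times_comm)

text \<open>Squaring acts on \<open>a \<ge> 1/2\<close> as \<open>2a - 1\<close> and doubling acts on \<open>a \<le> 1/2\<close> as \<open>2a\<close>. The next
identity and \<open>square_plus_small\<close> below compute \<open>2(x + y) - 1\<close> from such terms in \<open>x\<close> and \<open>y\<close>,
when one summand is at least \<open>1/2\<close> and when both are at most \<open>1/2\<close>.\<close>

lemma square_plus:
  assumes "x \<in> carrier A" "y \<in> carrier A" "x \<preceq> \<sim> y" "\<sim> y \<preceq> y"
  shows "(x \<oplus> y) \<odot> (x \<oplus> y) = (x \<oplus> x) \<oplus> (y \<odot> y)"
proof -
  have "\<sim> (x \<oplus> y) \<preceq> y"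
    using assms le_trans[of "\<sim> (x \<oplus> y)" "\<sim> y" y] by simp
  then have "(x \<oplus> y) \<odot> (x \<oplus> y) = x \<oplus> (y \<odot> (x \<oplus> y))"
    using plus_diff_assoc[of x y "\<sim> (x \<oplus> y)"] assms by simp
  then show ?thesis
    using assms by (simp add: times_plus_self plus_assoc)
qed

end

section \<open>Linearly ordered MV-algebras\<close>

locale mv_chain = mv_algebra +
  assumes total: "x \<in> carrier A \<Longrightarrow> y \<in> carrier A \<Longrightarrow> x \<preceq> y \<or> y \<preceq> x"
    and nontrivial: "\<zero> \<noteq> \<one>"
begin

text \<open>By linearity the larger factor is the smaller one plus some \<open>c\<close>, to which \<open>square_plus\<close>
applies.\<close>

lemma double_times:
  assumes "a \<in> carrier A" "b \<in> carrier A" "\<sim> a \<preceq> a" "\<sim> b \<preceq> b"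
  shows "(a \<odot> b) \<oplus> (a \<odot> b) = (a \<odot> a) \<oplus> (b \<odot> b)"
proof -
  have *: "(a \<odot> b) \<oplus> (a \<odot> b) = (a \<odot> a) \<oplus> (b \<odot> b)"
    if ab: "a \<in> carrier A" "b \<in> carrier A" "\<sim> a \<preceq> a" "a \<preceq> b" for a b
  proof -
    define c where "c = b \<odot> \<sim> a"
    have c: "c \<in> carrier A" "c \<preceq> \<sim> a"
      using ab by (simp_all add: c_def)
    have b: "b = c \<oplus> a"
      using ab by (simp add: c_def diff_plus_cancel)
    have "b \<odot> b = (c \<oplus> c) \<oplus> (a \<odot> a)"
      using square_plus[of c a] ab c by (simp add: b)
    moreover have "a \<odot> b = c \<oplus> (a \<odot> a)"
      using times_plus_self[of c a] ab c by (simp add: b)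
    ultimately show ?thesis
      using ab c by (simp add: plus_ac)
  qed
  show ?thesis
    using total[of a b] *[of a b] *[of b a] assms by (auto simp: times_comm plus_comm)
qed

lemma square_plus_small:
  assumes "x \<in> carrier A" "y \<in> carrier A" "x \<preceq> \<sim> x" "y \<preceq> \<sim> y"
  shows "(x \<oplus> y) \<odot> (x \<oplus> y) = (x \<oplus> x) \<odot> (y \<oplus> y)"
proof -
  have "\<sim> ((\<sim> x \<odot> \<sim> y) \<oplus> (\<sim> x \<odot> \<sim> y)) = \<sim> ((\<sim> x \<odot> \<sim> x) \<oplus> (\<sim> y \<odot> \<sim> y))"
    using double_times[of "\<sim> x" "\<sim> y"] assms by simp
  then show ?thesis
    using assms by (simp add: neg_plus neg_times)
qed

end

section \<open>Filters\<close>

definition mv_filter :: "('a, 'b) mv_algebra_scheme \<Rightarrow> 'a set \<Rightarrow> bool"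
  where "mv_filter A F \<longleftrightarrow> F \<subseteq> carrier A \<and> \<one>\<^bsub>A\<^esub> \<in> F \<and>
    (\<forall>x\<in>F. \<forall>y\<in>carrier A. x \<preceq>\<^bsub>A\<^esub> y \<longrightarrow> y \<in> F) \<and>
    (\<forall>x\<in>F. \<forall>y\<in>F. x \<odot>\<^bsub>A\<^esub> y \<in> F)"

lemma mv_filterI:
  assumes "F \<subseteq> carrier A" "\<one>\<^bsub>A\<^esub> \<in> F"
    and "\<And>x y. x \<in> F \<Longrightarrow> y \<in> carrier A \<Longrightarrow> x \<preceq>\<^bsub>A\<^esub> y \<Longrightarrow> y \<in> F"
    and "\<And>x y. x \<in> F \<Longrightarrow> y \<in> F \<Longrightarrow> x \<odot>\<^bsub>A\<^esub> y \<in> F"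
  shows "mv_filter A F"
  using assms unfolding mv_filter_def by blast

lemma mv_filterD:
  assumes "mv_filter A F"
  shows "x \<in> F \<Longrightarrow> x \<in> carrier A" "\<one>\<^bsub>A\<^esub> \<in> F"
    and "x \<in> F \<Longrightarrow> y \<in> carrier A \<Longrightarrow> x \<preceq>\<^bsub>A\<^esub> y \<Longrightarrow> y \<in> F"
    and "x \<in> F \<Longrightarrow> y \<in> F \<Longrightarrow> x \<odot>\<^bsub>A\<^esub> y \<in> F"
  using assms unfolding mv_filter_def by blast+

lemma mv_filter_Union_chain:
  assumes "\<C> \<noteq> {}" "\<And>F. F \<in> \<C> \<Longrightarrow> mv_filter A F"
    and "\<And>F G. F \<in> \<C> \<Longrightarrow> G \<in> \<C> \<Longrightarrow> F \<subseteq> G \<or> G \<subseteq> F"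
  shows "mv_filter A (\<Union>\<C>)"
proof (rule mv_filterI)
  show "\<Union>\<C> \<subseteq> carrier A"
    using assms(2) by (auto dest: mv_filterD(1))
  show "\<one>\<^bsub>A\<^esub> \<in> \<Union>\<C>"
    using assms(1,2) by (auto dest: mv_filterD(2))
  show "y \<in> \<Union>\<C>" if "x \<in> \<Union>\<C>" "y \<in> carrier A" "x \<preceq>\<^bsub>A\<^esub> y" for x y
    using that assms(2) mv_filterD(3) by (metis UnionE UnionI)
  show "x \<odot>\<^bsub>A\<^esub> y \<in> \<Union>\<C>" if "x \<in> \<Union>\<C>" "y \<in> \<Union>\<C>" for x y
    using that assms(2,3) mv_filterD(4) by (smt (verit) UnionE UnionI subsetD)
qed

context mv_algebra
begin

text \<open>The elements whose supremum with \<open>a\<close> lies in a filter form a filter again, because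
multiplication distributes over suprema. Primality of a maximal filter is obtained by comparing
it with these extensions.\<close>

lemma filter_residual:
  assumes F: "mv_filter A F" and a: "a \<in> carrier A"
  shows "mv_filter A {c \<in> carrier A. (c \<odot> \<sim> a) \<oplus> a \<in> F}"
proof (rule mv_filterI)
  show "\<one> \<in> {c \<in> carrier A. (c \<odot> \<sim> a) \<oplus> a \<in> F}"
    using a mv_filterD(2)[OF F] by simp
next
  fix c d assume c: "c \<in> {c \<in> carrier A. (c \<odot> \<sim> a) \<oplus> a \<in> F}" and d: "d \<in> carrier A" "c \<preceq> d"
  have "(c \<odot> \<sim> a) \<oplus> a \<preceq> (d \<odot> \<sim> a) \<oplus> a"
    using a c d by (intro plus_mono times_mono) simp_all
  then show "d \<in> {c \<in> carrier A. (c \<odot> \<sim> a) \<oplus> a \<in> F}"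
    using a c d mv_filterD(3)[OF F, of "(c \<odot> \<sim> a) \<oplus> a"] by simp
next
  fix c d assume c: "c \<in> {c \<in> carrier A. (c \<odot> \<sim> a) \<oplus> a \<in> F}"
    and d: "d \<in> {c \<in> carrier A. (c \<odot> \<sim> a) \<oplus> a \<in> F}"
  define w where "w = (c \<odot> d \<odot> \<sim> a) \<oplus> a"
  have car: "c \<in> carrier A" "d \<in> carrier A" "w \<in> carrier A"
    using a c d by (simp_all add: w_def)
  \<comment> \<open>By residuation it suffices that \<open>w\<close> bounds \<open>c \<odot> d\<close>, \<open>c \<odot> a\<close> and the product of
    \<open>a\<close> with the second supremum; any product with \<open>a\<close> is below \<open>a\<close>.\<close>
  have cd: "c \<odot> d \<preceq> w" and aw: "a \<preceq> w"
    using car a sup_upper[of "c \<odot> d" a] by (simp_all add: w_def)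
  have ad: "a \<odot> u \<preceq> w" if "u \<in> carrier A" for u
    using le_trans[of "a \<odot> u" a w] aw car a that by simp
  have "c \<odot> ((d \<odot> \<sim> a) \<oplus> a) \<preceq> w"
  proof -
    have "(d \<odot> \<sim> a) \<oplus> a \<preceq> \<sim> c \<oplus> w"
      using car a cd ad[of c] by (intro sup_least) (simp_all add: times_comm flip: residuation)
    then show ?thesis
      using car a residuation[of "(d \<odot> \<sim> a) \<oplus> a" c w] by (simp add: times_comm)
  qed
  then have "(c \<odot> \<sim> a) \<oplus> a \<preceq> \<sim> ((d \<odot> \<sim> a) \<oplus> a) \<oplus> w"
    using car a ad by (intro sup_least) (simp_all flip: residuation)
  then have "((c \<odot> \<sim> a) \<oplus> a) \<odot> ((d \<odot> \<sim> a) \<oplus> a) \<preceq> w"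
    using car a by (simp add: residuation)
  moreover have "((c \<odot> \<sim> a) \<oplus> a) \<odot> ((d \<odot> \<sim> a) \<oplus> a) \<in> F"
    using c d mv_filterD(4)[OF F] by simp
  ultimately have "w \<in> F"
    using car mv_filterD(3)[OF F] by blast
  then show "c \<odot> d \<in> {c \<in> carrier A. (c \<odot> \<sim> a) \<oplus> a \<in> F}"
    using car by (simp add: w_def)
qed auto

lemma filter_subset_residual:
  assumes F: "mv_filter A F" and a: "a \<in> carrier A"
  shows "F \<subseteq> {c \<in> carrier A. (c \<odot> \<sim> a) \<oplus> a \<in> F}"
proof
  fix c assume c: "c \<in> F"
  then have "c \<in> carrier A" using mv_filterD(1)[OF F] by blast
  then show "c \<in> {c \<in> carrier A. (c \<odot> \<sim> a) \<oplus> a \<in> F}"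
    using c a mv_filterD(3)[OF F c] sup_upper(1)[of c a] by simp
qed

text \<open>Let \<open>M\<^sub>e\<close> be the filter of the elements whose supremum with \<open>e\<close> lies in \<open>M\<close>. By maximality
\<open>M\<^sub>e = M\<close> unless \<open>z \<in> M\<^sub>e\<close>. If \<open>z \<notin> M\<^sub>b\<close>, then \<open>a \<in> M\<^sub>b = M\<close>. Otherwise \<open>b \<in> M\<^sub>z\<close> by
symmetry of suprema, and \<open>M\<^sub>z = M\<close> because the supremum of \<open>z\<close> with itself is \<open>z \<notin> M\<close>.\<close>

lemma maximal_filter_prime:
  assumes M: "mv_filter A M" and z: "z \<in> carrier A" "z \<notin> M"
    and max: "\<And>G. mv_filter A G \<Longrightarrow> M \<subseteq> G \<Longrightarrow> z \<notin> G \<Longrightarrow> G = M"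
    and ab: "a \<in> carrier A" "b \<in> carrier A" "(a \<odot> \<sim> b) \<oplus> b \<in> M"
  shows "a \<in> M \<or> b \<in> M"
proof -
  have residual: "c \<in> M"
    if "e \<in> carrier A" "(z \<odot> \<sim> e) \<oplus> e \<notin> M" "c \<in> carrier A" "(c \<odot> \<sim> e) \<oplus> e \<in> M" for c e
    using max[OF filter_residual[OF M] filter_subset_residual[OF M], of e] that by blast
  show ?thesis
  proof (cases "(z \<odot> \<sim> b) \<oplus> b \<in> M")
    case True
    then have "(b \<odot> \<sim> z) \<oplus> z \<in> M"
      using z ab sup_commute[of z b] by simp
    moreover have "(z \<odot> \<sim> z) \<oplus> z \<notin> M"
      using z by simp
    ultimately show ?thesis
      using residual[of z b] z ab by blast
  next
    case False
    then show ?thesis using residual[of b a] ab by blast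
  qed
qed

lemma prime_filter_exists:
  assumes F: "mv_filter A F" and z: "z \<in> carrier A" "z \<notin> F"
  obtains M where "mv_filter A M" "F \<subseteq> M" "z \<notin> M"
    "\<And>x y. x \<in> carrier A \<Longrightarrow> y \<in> carrier A \<Longrightarrow> \<sim> x \<oplus> y \<in> M \<or> \<sim> y \<oplus> x \<in> M"
proof -
  define \<F> where "\<F> = {G. mv_filter A G \<and> F \<subseteq> G \<and> z \<notin> G}"
  have "\<exists>M\<in>\<F>. \<forall>G\<in>\<F>. M \<subseteq> G \<longrightarrow> G = M"
  proof (rule subset_Zorn_nonempty)
    show "\<F> \<noteq> {}"
      using F z by (auto simp: \<F>_def)
    fix \<C> assume nonempty: "\<C> \<noteq> {}" and chain: "subset.chain \<F> \<C>"
    have sub: "mv_filter A G" "F \<subseteq> G" "z \<notin> G" if "G \<in> \<C>" for G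
      using that chain by (auto simp: subset_chain_def \<F>_def)
    have "mv_filter A (\<Union>\<C>)"
      using nonempty sub(1) chain by (intro mv_filter_Union_chain) (auto simp: subset_chain_def)
    moreover have "F \<subseteq> \<Union>\<C>" "z \<notin> \<Union>\<C>"
      using nonempty sub(2,3) by auto
    ultimately show "\<Union>\<C> \<in> \<F>"
      by (simp add: \<F>_def)
  qed
  then obtain M where "M \<in> \<F>" and maximal: "\<forall>G\<in>\<F>. M \<subseteq> G \<longrightarrow> G = M" ..
  then have M: "mv_filter A M" "F \<subseteq> M" "z \<notin> M"
    by (simp_all add: \<F>_def)
  have max: "G = M" if "mv_filter A G" "M \<subseteq> G" "z \<notin> G" for G
  proof -
    have "G \<in> \<F>"
      using that M(2) by (simp add: \<F>_def)
    with maximal that(2) show ?thesis by simp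
  qed
  have "\<sim> x \<oplus> y \<in> M \<or> \<sim> y \<oplus> x \<in> M" if xy: "x \<in> carrier A" "y \<in> carrier A" for x y
  proof (rule maximal_filter_prime[OF M(1) z(1) M(3) max])
    have "((\<sim> x \<oplus> y) \<odot> \<sim> (\<sim> y \<oplus> x)) \<oplus> (\<sim> y \<oplus> x) = \<one>"
      using xy sup_upper[of "\<sim> x \<oplus> y" "\<sim> y \<oplus> x"] by (intro prelinear[of x y]) simp_all
    then show "((\<sim> x \<oplus> y) \<odot> \<sim> (\<sim> y \<oplus> x)) \<oplus> (\<sim> y \<oplus> x) \<in> M"
      using mv_filterD(2)[OF M(1)] by simp
  qed (use xy in simp_all)
  with that M show thesis by blast
qed

end

section \<open>Quotients by filters\<close>

locale mv_quotient = mv_algebra +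
  fixes M
  assumes filter: "mv_filter A M"
begin

definition cong :: "'a \<Rightarrow> 'a \<Rightarrow> bool"  (infix \<open>\<approx>\<close> 50)
  where "x \<approx> y \<longleftrightarrow> \<sim> x \<oplus> y \<in> M \<and> \<sim> y \<oplus> x \<in> M"

lemma filter_trans:
  assumes "x \<in> carrier A" "y \<in> carrier A" "z \<in> carrier A" "\<sim> x \<oplus> y \<in> M" "\<sim> y \<oplus> z \<in> M"
  shows "\<sim> x \<oplus> z \<in> M"
proof -
  have "(\<sim> y \<oplus> z) \<odot> y \<preceq> z"
    using assms by (simp add: residuation)
  then have "((\<sim> y \<oplus> z) \<odot> y) \<oplus> \<sim> x \<preceq> z \<oplus> \<sim> x"
    using assms by (intro plus_mono) simp_all
  moreover have "(\<sim> x \<oplus> y) \<odot> x \<preceq> y"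
    using assms by (simp add: residuation)
  then have "(\<sim> y \<oplus> z) \<odot> ((\<sim> x \<oplus> y) \<odot> x) \<preceq> (\<sim> y \<oplus> z) \<odot> y"
    using assms by (intro times_mono) simp_all
  then have "(\<sim> y \<oplus> z) \<odot> ((\<sim> x \<oplus> y) \<odot> x) \<preceq> z"
    using assms \<open>(\<sim> y \<oplus> z) \<odot> y \<preceq> z\<close>
      le_trans[of "(\<sim> y \<oplus> z) \<odot> ((\<sim> x \<oplus> y) \<odot> x)" "(\<sim> y \<oplus> z) \<odot> y" z] by simp
  then have "(\<sim> y \<oplus> z) \<odot> (\<sim> x \<oplus> y) \<preceq> \<sim> x \<oplus> z"
    using assms by (simp add: times_assoc flip: residuation)
  then show ?thesis
    using assms mv_filterD(3)[OF filter mv_filterD(4)[OF filter assms(5,4)]] by simp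
qed

lemma cong_refl [simp]: "x \<in> carrier A \<Longrightarrow> x \<approx> x"
  using mv_filterD(2)[OF filter] by (simp add: cong_def)

lemma cong_sym: "x \<approx> y \<Longrightarrow> y \<approx> x"
  by (simp add: cong_def)

lemma cong_trans:
  "x \<in> carrier A \<Longrightarrow> y \<in> carrier A \<Longrightarrow> z \<in> carrier A \<Longrightarrow> x \<approx> y \<Longrightarrow> y \<approx> z \<Longrightarrow> x \<approx> z"
  unfolding cong_def using filter_trans by blast

lemma cong_neg: "x \<in> carrier A \<Longrightarrow> y \<in> carrier A \<Longrightarrow> x \<approx> y \<Longrightarrow> \<sim> x \<approx> \<sim> y"
  by (simp add: cong_def plus_comm)

lemma cong_plus_left:
  assumes "x \<in> carrier A" "y \<in> carrier A" "z \<in> carrier A" "x \<approx> y"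
  shows "x \<oplus> z \<approx> y \<oplus> z"
proof -
  have "\<sim> (a \<oplus> z) \<oplus> (b \<oplus> z) \<in> M"
    if ab: "a \<in> carrier A" "b \<in> carrier A" "\<sim> a \<oplus> b \<in> M" for a b
  proof -
    have "\<sim> (a \<oplus> z) \<oplus> (b \<oplus> z) = ((\<sim> a \<odot> \<sim> z) \<oplus> z) \<oplus> b"
      using ab assms by (simp add: neg_plus plus_ac)
    moreover have "\<sim> a \<oplus> b \<preceq> ((\<sim> a \<odot> \<sim> z) \<oplus> z) \<oplus> b"
      using ab assms sup_upper[of "\<sim> a" z] by (intro plus_mono) simp_all
    ultimately show ?thesis
      using mv_filterD(3)[OF filter ab(3)] ab assms by simp
  qed
  then show ?thesis
    using assms by (simp add: cong_def)
qed

lemma cong_plus: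
  assumes "x \<in> carrier A" "x' \<in> carrier A" "y \<in> carrier A" "y' \<in> carrier A" "x \<approx> x'" "y \<approx> y'"
  shows "x \<oplus> y \<approx> x' \<oplus> y'"
proof -
  have "x \<oplus> y \<approx> x' \<oplus> y"
    using assms by (simp add: cong_plus_left)
  moreover have "x' \<oplus> y \<approx> x' \<oplus> y'"
    using assms cong_plus_left[of y y' x'] by (simp add: plus_comm)
  ultimately show ?thesis
    using assms cong_trans[of "x \<oplus> y" "x' \<oplus> y" "x' \<oplus> y'"] by simp
qed

text \<open>A system of representatives replaces the set of congruence classes, so that the quotient has
elements of the same type as the algebra it comes from.\<close>

definition rep :: "'a \<Rightarrow> 'a"
  where "rep x = (SOME y. y \<in> carrier A \<and> y \<approx> x)"

lemma rep:
  assumes "x \<in> carrier A"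
  shows "rep x \<in> carrier A" "rep x \<approx> x"
  using someI[of "\<lambda>y. y \<in> carrier A \<and> y \<approx> x" x] assms by (simp_all add: rep_def)

lemma rep_eq_iff:
  assumes "x \<in> carrier A" "y \<in> carrier A"
  shows "rep x = rep y \<longleftrightarrow> x \<approx> y"
proof
  assume "rep x = rep y"
  then show "x \<approx> y"
    using rep assms cong_sym cong_trans by metis
next
  assume "x \<approx> y"
  then have "(z \<in> carrier A \<and> z \<approx> x) = (z \<in> carrier A \<and> z \<approx> y)" for z
    using assms cong_sym cong_trans by metis
  then show "rep x = rep y"
    by (simp add: rep_def)
qed

definition quotient :: "'a mv_algebra"
  where "quotient = \<lparr>carrier = rep ` carrier A, mv_plus = (\<lambda>x y. rep (x \<oplus> y)),
    mv_neg = (\<lambda>x. rep (\<sim> x)), mv_zero = rep \<zero>\<rparr>"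

lemma rep_plus: "x \<in> carrier A \<Longrightarrow> y \<in> carrier A \<Longrightarrow> rep (rep x \<oplus> rep y) = rep (x \<oplus> y)"
  by (simp add: rep rep_eq_iff cong_plus)

lemma rep_neg: "x \<in> carrier A \<Longrightarrow> rep (\<sim> (rep x)) = rep (\<sim> x)"
  by (simp add: rep rep_eq_iff cong_neg)

lemma quotient_simps [simp]:
  "carrier quotient = rep ` carrier A"
  "x \<in> carrier A \<Longrightarrow> y \<in> carrier A \<Longrightarrow> rep x \<oplus>\<^bsub>quotient\<^esub> rep y = rep (x \<oplus> y)"
  "x \<in> carrier A \<Longrightarrow> \<sim>\<^bsub>quotient\<^esub> (rep x) = rep (\<sim> x)"
  "\<zero>\<^bsub>quotient\<^esub> = rep \<zero>"
  by (simp_all add: quotient_def rep_plus rep_neg)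

lemma quotient_one [simp]: "\<one>\<^bsub>quotient\<^esub> = rep \<one>"
  by (simp add: mv_one_def[of quotient])

lemma quotient_times [simp]:
  "x \<in> carrier A \<Longrightarrow> y \<in> carrier A \<Longrightarrow> rep x \<odot>\<^bsub>quotient\<^esub> rep y = rep (x \<odot> y)"
  by (simp add: mv_times_def)

lemma mv_algebra_quotient: "mv_algebra quotient"
proof
  show "\<And>x y. x \<in> carrier quotient \<Longrightarrow> y \<in> carrier quotient \<Longrightarrow>
    \<sim>\<^bsub>quotient\<^esub> (\<sim>\<^bsub>quotient\<^esub> x \<oplus>\<^bsub>quotient\<^esub> y) \<oplus>\<^bsub>quotient\<^esub> y =
    \<sim>\<^bsub>quotient\<^esub> (\<sim>\<^bsub>quotient\<^esub> y \<oplus>\<^bsub>quotient\<^esub> x) \<oplus>\<^bsub>quotient\<^esub> x"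
    by (auto simp: lukasiewicz)
qed (auto simp: plus_ac)

lemma rep_hom: "rep \<in> mv_hom A quotient"
  by (auto simp: mv_hom_def)

lemma rep_eq_one_iff: "x \<in> carrier A \<Longrightarrow> rep x = \<one>\<^bsub>quotient\<^esub> \<longleftrightarrow> x \<in> M"
  using mv_filterD(2)[OF filter] by (auto simp: rep_eq_iff cong_def)

lemma mv_chain_quotient:
  assumes "\<And>x y. x \<in> carrier A \<Longrightarrow> y \<in> carrier A \<Longrightarrow> \<sim> x \<oplus> y \<in> M \<or> \<sim> y \<oplus> x \<in> M"
    and "\<zero> \<notin> M"
  shows "mv_chain quotient"
proof -
  interpret Q: mv_algebra quotient by (rule mv_algebra_quotient)
  have "rep x \<preceq>\<^bsub>quotient\<^esub> rep y \<longleftrightarrow> \<sim> x \<oplus> y \<in> M" if "x \<in> carrier A" "y \<in> carrier A" for x y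
    using that rep_eq_one_iff[of "\<sim> x \<oplus> y"] by (simp add: mv_le_def)
  with assms show ?thesis
    using rep_eq_one_iff[of \<zero>] by unfold_locales auto
qed

end

text \<open>The chain is the quotient by a prime filter that contains \<open>F\<close> but not \<open>z\<close>. It may contain
infinitesimals, as such a filter need not be a maximal proper one.\<close>

theorem filter_separation_by_chain:
  fixes A :: "('a, 'b) mv_algebra_scheme"
  assumes "mv_algebra A" "mv_filter A F" "z \<in> carrier A" "z \<notin> F"
  obtains C :: "'a mv_algebra" and h where "mv_chain C" "h \<in> mv_hom A C"
    "\<And>x. x \<in> F \<Longrightarrow> h x = \<one>\<^bsub>C\<^esub>" "h z \<noteq> \<one>\<^bsub>C\<^esub>"
proof -
  interpret mv_algebra A by fact
  obtain M where M: "mv_filter A M" "F \<subseteq> M" "z \<notin> M"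
    and linear: "\<And>x y. x \<in> carrier A \<Longrightarrow> y \<in> carrier A \<Longrightarrow> \<sim>\<^bsub>A\<^esub> x \<oplus>\<^bsub>A\<^esub> y \<in> M \<or> \<sim>\<^bsub>A\<^esub> y \<oplus>\<^bsub>A\<^esub> x \<in> M"
    using prime_filter_exists[OF assms(2,3,4)] by blast
  interpret mv_quotient A M
    by unfold_locales (rule M(1))
  have "rep x = \<one>\<^bsub>quotient\<^esub>" if "x \<in> F" for x
    using that M mv_filterD(1)[OF assms(2)] rep_eq_one_iff by blast
  moreover have "rep z \<noteq> \<one>\<^bsub>quotient\<^esub>"
    using M assms(3) rep_eq_one_iff by blast
  moreover have "\<zero>\<^bsub>A\<^esub> \<notin> M"
    using M assms(3) mv_filterD(3)[OF M(1)] by (metis zero_le)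
  ultimately show thesis
    using that[OF mv_chain_quotient[OF linear] rep_hom] by blast
qed

text \<open>The principle behind the functional equations of binary expansions: a bounded error that is
always at most half of another error of the same kind vanishes.\<close>

lemma zero_if_halving:
  fixes f :: "'x \<Rightarrow> real"
  assumes "p \<in> S" and bound: "\<And>p. p \<in> S \<Longrightarrow> \<bar>f p\<bar> \<le> B"
    and halving: "\<And>p. p \<in> S \<Longrightarrow> \<exists>q\<in>S. \<bar>f p\<bar> \<le> \<bar>f q\<bar> / 2"
  shows "f p = 0"
proof -
  have *: "\<bar>f p\<bar> \<le> B * (1 / 2) ^ n" if "p \<in> S" for p n
    using that
  proof (induction n arbitrary: p)
    case 0
    then show ?case using bound by simp
  next
    case (Suc n)
    obtain q where "q \<in> S" "\<bar>f p\<bar> \<le> \<bar>f q\<bar> / 2"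
      using halving[OF Suc.prems] by blast
    with Suc.IH[of q] show ?case by simp
  qed
  have "(\<lambda>n. B * (1 / 2) ^ n) \<longlonglongrightarrow> B * 0"
    by (intro tendsto_mult_left LIMSEQ_power_zero) simp
  then have "\<bar>f p\<bar> \<le> B * 0"
    using *[OF \<open>p \<in> S\<close>] by (intro LIMSEQ_le_const) auto
  then show ?thesis by simp
qed

section \<open>Binary expansions in MV-chains\<close>

context mv_chain
begin

text \<open>An element \<open>x\<close> has leading binary digit 1 if it lies in the upper half of the chain; removing
this digit amounts to replacing \<open>x\<close> by \<open>2x - 1\<close>, otherwise by \<open>2x\<close>. Iteration produces a real
number from any chain, Archimedean or not; infinitesimal differences disappear in it.\<close>

definition upper :: "'a \<Rightarrow> bool"
  where "upper x \<longleftrightarrow> x \<oplus> x = \<one>"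

definition shift :: "'a \<Rightarrow> 'a"
  where "shift x = (if upper x then x \<odot> x else x \<oplus> x)"

definition expansion :: "'a \<Rightarrow> real"
  where "expansion x = (\<Sum>k. of_bool (upper ((shift ^^ k) x)) * (1 / 2) ^ Suc k)"

lemma shift_closed [simp]: "x \<in> carrier A \<Longrightarrow> shift x \<in> carrier A"
  by (simp add: shift_def)

lemma summable_expansion: "summable (\<lambda>k. of_bool (upper ((shift ^^ k) x)) * (1 / 2 :: real) ^ Suc k)"
  by (rule summable_comparison_test'[of "\<lambda>k. (1 / 2) ^ Suc k" 0])
    (use sums_summable[OF power_half_series] in auto)

lemma expansion_nonneg: "0 \<le> expansion x"
  unfolding expansion_def by (intro suminf_nonneg summable_expansion) simp

lemma expansion_le_one: "expansion x \<le> 1"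
proof -
  have "expansion x \<le> (\<Sum>k. (1 / 2 :: real) ^ Suc k)"
    unfolding expansion_def using sums_summable[OF power_half_series]
    by (intro suminf_le summable_expansion) auto
  also have "\<dots> = 1"
    using sums_unique[OF power_half_series] by simp
  finally show ?thesis .
qed

lemma expansion_rec: "expansion x = (of_bool (upper x) + expansion (shift x)) / 2"
proof -
  have "expansion x = (\<Sum>k. of_bool (upper ((shift ^^ Suc k) x)) * (1 / 2) ^ Suc (Suc k)) + of_bool (upper x) / 2"
    unfolding expansion_def using suminf_split_head[OF summable_expansion[of x]] by simp
  also have "(\<Sum>k. of_bool (upper ((shift ^^ Suc k) x)) * (1 / 2 :: real) ^ Suc (Suc k)) =
      (\<Sum>k. (1 / 2) * (of_bool (upper ((shift ^^ k) (shift x))) * (1 / 2) ^ Suc k))"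
    by (simp add: funpow_Suc_right del: funpow.simps)
  also have "\<dots> = (1 / 2) * expansion (shift x)"
    unfolding expansion_def by (rule suminf_mult[OF summable_expansion])
  finally show ?thesis by (simp add: field_simps)
qed

lemma expansion_upper: "upper x \<Longrightarrow> expansion x = (1 + expansion (x \<odot> x)) / 2"
  using expansion_rec[of x] by (simp add: shift_def)

lemma expansion_lower: "\<not> upper x \<Longrightarrow> expansion x = expansion (x \<oplus> x) / 2"
  using expansion_rec[of x] by (simp add: shift_def)

lemma upper_iff: "x \<in> carrier A \<Longrightarrow> upper x \<longleftrightarrow> \<sim> x \<preceq> x"
  by (simp add: upper_def neg_le_iff)

lemma not_upper: "x \<in> carrier A \<Longrightarrow> \<not> upper x \<Longrightarrow> x \<preceq> \<sim> x"
  using total[of x "\<sim> x"] by (auto simp: upper_iff)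

lemma expansion_zero: "expansion \<zero> = 0"
  using expansion_lower[of \<zero>] nontrivial by (simp add: upper_def)

lemma expansion_one: "expansion \<one> = 1"
  using expansion_upper[of \<one>] by (simp add: upper_def)

text \<open>Negation exchanges the digits 0 and 1, and commutes with the removal of the leading digit. This
breaks down only at a fixed point of negation, but its digits are \<open>1000...\<close>, of value \<open>1/2\<close>.\<close>

lemma expansion_neg:
  assumes "x \<in> carrier A"
  shows "expansion (\<sim> x) = 1 - expansion x"
proof -
  let ?f = "\<lambda>x. expansion x + expansion (\<sim> x) - 1"
  have lower: "\<bar>?f x\<bar> \<le> \<bar>?f (x \<oplus> x)\<bar> / 2" if x: "x \<in> carrier A" "\<not> upper x" for x
  proof -
    have "upper (\<sim> x)"
      using x not_upper[of x] by (simp add: upper_iff)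
    then have "expansion (\<sim> x) = (1 + expansion (\<sim> (x \<oplus> x))) / 2"
      using x expansion_upper[of "\<sim> x"] by (simp add: neg_plus)
    then have "?f x = ?f (x \<oplus> x) / 2"
      using expansion_lower[of x] x by simp
    then show ?thesis
      by (simp only: abs_divide abs_numeral order_refl)
  qed
  have "?f x = 0"
  proof (rule zero_if_halving[OF assms, of _ 1])
    fix x assume x: "x \<in> carrier A"
    show "\<bar>?f x\<bar> \<le> 1"
      using expansion_nonneg[of x] expansion_nonneg[of "\<sim> x"]
        expansion_le_one[of x] expansion_le_one[of "\<sim> x"] by linarith
    consider "\<not> upper x" | "\<not> upper (\<sim> x)" | "upper x" "upper (\<sim> x)" by blast
    then show "\<exists>q\<in>carrier A. \<bar>?f x\<bar> \<le> \<bar>?f q\<bar> / 2"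
    proof cases
      case 1
      show ?thesis
        using x lower[OF x 1] by (intro bexI[of _ "x \<oplus> x"]) simp_all
    next
      case 2
      show ?thesis
        using x 2 lower[of "\<sim> x"] by (intro bexI[of _ "\<sim> x \<oplus> \<sim> x"]) (simp_all add: add.commute)
    next
      case 3
      then have fixed: "\<sim> x = x"
        using x by (intro le_antisym) (simp_all add: upper_iff)
      then have "x \<odot> x = \<zero>"
        using x times_neg_self[of x] by simp
      then have "?f x = 0"
        using expansion_upper[OF 3(1)] by (simp add: fixed expansion_zero)
      then show ?thesis
        using x by (intro bexI[of _ x]) simp_all
    qed
  qed
  then show ?thesis by simp
qed

text \<open>For a pair with an untruncated sum, removing the leading digits of \<open>x\<close>, \<open>y\<close> and \<open>x \<oplus> y\<close>
turns the additivity error of the pair into half the error of another such pair, up to sign,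
unless \<open>x\<close> and \<open>y\<close> both equal the fixed point of negation, where the error is zero. The case
that changes the sign is a carry into the leading digit: there the sum of the doubles overflows,
and one passes to the pair of their negations, whose sum does not.\<close>

lemma expansion_plus_disjoint:
  assumes "x \<in> carrier A" "y \<in> carrier A" "x \<preceq> \<sim> y"
  shows "expansion (x \<oplus> y) = expansion x + expansion y"
proof -
  define S where "S = {(x, y). x \<in> carrier A \<and> y \<in> carrier A \<and> x \<preceq> \<sim> y}"
  define f where "f = (\<lambda>(x, y). expansion (x \<oplus> y) - expansion x - expansion y)"
  have mixed: "\<exists>q\<in>S. \<bar>f (x, y)\<bar> \<le> \<bar>f q\<bar> / 2"
    if xy: "x \<in> carrier A" "y \<in> carrier A" "x \<preceq> \<sim> y" "\<not> upper x" "upper y" for x y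
  proof (rule bexI)
    have "\<one> \<preceq> (x \<oplus> y) \<oplus> (x \<oplus> y)"
      using xy plus_mono[of y y "x \<oplus> y" "x \<oplus> y"] by (simp add: upper_def)
    then have "upper (x \<oplus> y)"
      using xy by (simp add: upper_def one_le_iff)
    moreover have "(x \<oplus> y) \<odot> (x \<oplus> y) = (x \<oplus> x) \<oplus> (y \<odot> y)"
      using xy by (simp add: square_plus upper_iff)
    ultimately have "f (x, y) = f (x \<oplus> x, y \<odot> y) / 2"
      using expansion_upper[of "x \<oplus> y"] expansion_upper[of y] expansion_lower[of x] xy
      by (simp add: f_def field_simps)
    then show "\<bar>f (x, y)\<bar> \<le> \<bar>f (x \<oplus> x, y \<odot> y)\<bar> / 2"
      by simp
    show "(x \<oplus> x, y \<odot> y) \<in> S"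
      using xy by (simp add: S_def neg_times plus_mono)
  qed
  have "f (x, y) = 0"
  proof (rule zero_if_halving[of _ S _ 2])
    show "(x, y) \<in> S"
      using assms by (simp add: S_def)
    fix p assume "p \<in> S"
    then obtain x y where p: "p = (x, y)" and xy: "x \<in> carrier A" "y \<in> carrier A" "x \<preceq> \<sim> y"
      by (auto simp: S_def)
    show "\<bar>f p\<bar> \<le> 2"
      using expansion_nonneg[of x] expansion_nonneg[of y] expansion_nonneg[of "x \<oplus> y"]
        expansion_le_one[of x] expansion_le_one[of y] expansion_le_one[of "x \<oplus> y"]
      unfolding p f_def by simp
    consider "upper x" "upper y" | "\<not> upper x" "upper y" | "upper x" "\<not> upper y"
      | "\<not> upper x" "\<not> upper y" "upper (x \<oplus> y)" | "\<not> upper x" "\<not> upper y" "\<not> upper (x \<oplus> y)"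
      by blast
    then show "\<exists>q\<in>S. \<bar>f p\<bar> \<le> \<bar>f q\<bar> / 2"
    proof cases
      case 1
      have "y \<preceq> \<sim> x" "\<sim> x \<preceq> x" "\<sim> y \<preceq> y"
        using 1 xy by (simp_all add: upper_iff le_neg_commute)
      then have "y \<preceq> x" "x \<preceq> y"
        using xy le_trans[of y "\<sim> x" x] le_trans[of x "\<sim> y" y] by simp_all
      then have eq: "x = y"
        using xy by (intro le_antisym)
      then have "\<sim> x = x"
        using \<open>\<sim> x \<preceq> x\<close> xy by (intro le_antisym) simp_all
      then have "expansion x = 1 / 2"
        using expansion_neg[OF xy(1)] by simp
      moreover have "x \<oplus> y = \<one>"
        using 1 eq by (simp add: upper_def)
      ultimately have "f p = 0"
        using eq by (simp add: f_def p expansion_one)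
      then show ?thesis
        using \<open>p \<in> S\<close> by (intro bexI[of _ p]) simp_all
    next
      case 2
      then show ?thesis using mixed xy p by simp
    next
      case 3
      then have "\<exists>q\<in>S. \<bar>f (y, x)\<bar> \<le> \<bar>f q\<bar> / 2"
        using mixed[of y x] xy by (simp add: le_neg_commute)
      moreover have "f (y, x) = f p"
        using xy by (simp add: f_def p plus_comm)
      ultimately show ?thesis by simp
    next
      case 4
      have "\<sim> (x \<oplus> x) \<preceq> \<sim> (\<sim> (y \<oplus> y))"
        using 4 xy by (simp add: upper_def neg_le_iff plus_ac)
      then have "(\<sim> (x \<oplus> x), \<sim> (y \<oplus> y)) \<in> S"
        using xy by (simp add: S_def)
      moreover have "(x \<oplus> y) \<odot> (x \<oplus> y) = \<sim> (\<sim> (x \<oplus> x) \<oplus> \<sim> (y \<oplus> y))"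
        using 4 xy square_plus_small[of x y] not_upper by (simp add: neg_plus neg_times)
      then have "f p = - f (\<sim> (x \<oplus> x), \<sim> (y \<oplus> y)) / 2"
        using expansion_upper[OF 4(3)] expansion_lower[OF 4(1)] expansion_lower[OF 4(2)] xy
        by (simp add: f_def p expansion_neg field_simps)
      then have "\<bar>f p\<bar> \<le> \<bar>f (\<sim> (x \<oplus> x), \<sim> (y \<oplus> y))\<bar> / 2"
        by simp
      ultimately show ?thesis by blast
    next
      case 5
      have "(x \<oplus> x) \<odot> (y \<oplus> y) = (x \<oplus> y) \<odot> (x \<oplus> y)"
        using 5 xy square_plus_small[of x y] not_upper by simp
      also have "\<dots> = \<zero>"
        using not_upper[of "x \<oplus> y"] 5 xy by (simp add: le_iff_times_zero)
      finally have "(x \<oplus> x, y \<oplus> y) \<in> S"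
        using xy by (simp add: S_def le_iff_times_zero)
      moreover have "(x \<oplus> y) \<oplus> (x \<oplus> y) = (x \<oplus> x) \<oplus> (y \<oplus> y)"
        using xy by (simp add: plus_ac)
      then have "f p = f (x \<oplus> x, y \<oplus> y) / 2"
        using expansion_lower[OF 5(1)] expansion_lower[OF 5(2)] expansion_lower[OF 5(3)]
        by (simp add: f_def p field_simps)
      then have "\<bar>f p\<bar> \<le> \<bar>f (x \<oplus> x, y \<oplus> y)\<bar> / 2"
        by simp
      ultimately show ?thesis by blast
    qed
  qed
  then show ?thesis by (simp add: f_def)
qed

lemma expansion_mono:
  assumes "x \<in> carrier A" "y \<in> carrier A" "x \<preceq> y"
  shows "expansion x \<le> expansion y"
  using expansion_plus_disjoint[of "y \<odot> \<sim> x" x] assms expansion_nonneg[of "y \<odot> \<sim> x"]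
  by (simp add: diff_plus_cancel)

lemma expansion_plus:
  assumes "x \<in> carrier A" "y \<in> carrier A"
  shows "expansion (x \<oplus> y) = min 1 (expansion x + expansion y)"
proof (cases "x \<preceq> \<sim> y")
  case True
  then show ?thesis
    using expansion_plus_disjoint[OF assms] expansion_le_one[of "x \<oplus> y"] by simp
next
  case False
  then have le: "\<sim> y \<preceq> x"
    using total[of x "\<sim> y"] assms by simp
  then have "x \<oplus> y = \<one>"
    using assms by (simp add: neg_le_iff plus_comm)
  then show ?thesis
    using expansion_mono[OF _ _ le] assms by (simp add: expansion_neg expansion_one)
qed

lemma expansion_hom: "expansion \<in> mv_hom A standard_mv"
  using expansion_nonneg expansion_le_one
  by (auto simp: mv_hom_def expansion_plus expansion_neg expansion_zero expansion_one
      mv_times_def[of A] min_def max_def)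

end

section \<open>Dyadic thresholds\<close>

text \<open>A word of bits denotes the dyadic number in \<open>(0, 1]\<close> whose binary digits are the word followed
by \<open>111...\<close>. The associated term doubles or squares its argument accordingly; in the standard
algebra it takes the value 1 exactly on the arguments that are at least that number.\<close>

fun dyadic :: "bool list \<Rightarrow> real"
  where "dyadic [] = 1"
  | "dyadic (b # w) = (of_bool b + dyadic w) / 2"

fun threshold :: "('a, 'b) mv_algebra_scheme \<Rightarrow> bool list \<Rightarrow> 'a \<Rightarrow> 'a"
  where "threshold A [] x = x"
  | "threshold A (b # w) x =
      threshold A w (if b then x \<odot>\<^bsub>A\<^esub> x else x \<oplus>\<^bsub>A\<^esub> x)"

lemma dyadic_pos: "0 < dyadic w"
  by (induction w) auto

lemma dyadic_le_one: "dyadic w \<le> 1"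
  by (induction w) auto

lemma dyadic_dense:
  assumes "0 \<le> r" "r < q" "q \<le> 1"
  obtains w where "r < dyadic w" "dyadic w \<le> q"
proof -
  have "\<exists>w. r < dyadic w \<and> dyadic w \<le> q" if "0 \<le> r" "q \<le> 1" "(1 / 2) ^ n < q - r" for n r q
    using that
  proof (induction n arbitrary: r q)
    case 0
    then show ?case by simp
  next
    case (Suc n)
    consider "q \<le> 1 / 2" | "1 / 2 \<le> r" | "r < 1 / 2" "1 / 2 < q" by linarith
    then show ?case
    proof cases
      case 1
      obtain w where "2 * r < dyadic w" "dyadic w \<le> 2 * q"
        using Suc.IH[of "2 * r" "2 * q"] Suc.prems 1 by auto
      then show ?thesis by (intro exI[of _ "False # w"]) simp
    next
      case 2
      obtain w where "2 * r - 1 < dyadic w" "dyadic w \<le> 2 * q - 1"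
        using Suc.IH[of "2 * r - 1" "2 * q - 1"] Suc.prems 2 by auto
      then show ?thesis by (intro exI[of _ "True # w"]) simp
    next
      case 3
      then show ?thesis by (intro exI[of _ "[False]"]) simp
    qed
  qed
  moreover obtain n where "(1 / 2 :: real) ^ n < q - r"
    using real_arch_pow_inv[of "q - r" "1 / 2"] assms by auto
  ultimately show thesis
    using that assms by blast
qed

lemma threshold_standard_mv:
  "a \<in> {0..1} \<Longrightarrow> threshold standard_mv w a = 1 \<longleftrightarrow> dyadic w \<le> a"
proof (induction w arbitrary: a)
  case Nil
  then show ?case by auto
next
  case (Cons b w)
  then show ?case
    using dyadic_pos[of w] dyadic_le_one[of w] by (auto simp: min_def max_def)
qed

lemma (in mv_algebra) threshold_closed [simp]:
  "x \<in> carrier A \<Longrightarrow> threshold A w x \<in> carrier A"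
  by (induction w arbitrary: x) simp_all

text \<open>Thresholds are built from doubling and squaring alone, which is all that semi-states are
required to preserve.\<close>

lemma threshold_commute:
  assumes "mv_algebra A" "x \<in> carrier A"
    and "\<And>x. x \<in> carrier A \<Longrightarrow> h (x \<oplus>\<^bsub>A\<^esub> x) = h x \<oplus>\<^bsub>B\<^esub> h x"
    and "\<And>x. x \<in> carrier A \<Longrightarrow> h (x \<odot>\<^bsub>A\<^esub> x) = h x \<odot>\<^bsub>B\<^esub> h x"
  shows "h (threshold A w x) = threshold B w (h x)"
proof -
  interpret mv_algebra A by fact
  show ?thesis
    using assms(2) by (induction w arbitrary: x) (simp_all add: assms(3,4))
qed

lemma threshold_hom:
  assumes "mv_algebra A" "h \<in> mv_hom A B" "x \<in> carrier A"
  shows "h (threshold A w x) = threshold B w (h x)"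
  using assms by (intro threshold_commute) (auto simp: mv_hom_def)

lemma threshold_semi_state:
  assumes "mv_algebra A" "semi_state A t" "x \<in> carrier A"
  shows "t (threshold A w x) = threshold standard_mv w (t x)"
  using assms by (intro threshold_commute) (auto simp: semi_state_def)

lemma (in mv_algebra) threshold_one: "threshold A w \<one> = \<one>"
  by (induction w) simp_all

text \<open>In a chain with infinitesimals an element need not pass a threshold that equals its expansion,
but it passes every strictly smaller one, as a comparison of the digits shows.\<close>

lemma (in mv_chain) threshold_of_expansion:
  "x \<in> carrier A \<Longrightarrow> dyadic w < expansion x \<Longrightarrow> threshold A w x = \<one>"
proof (induction w arbitrary: x)
  case Nil
  then show ?case
    using expansion_le_one[of x] by simp
next
  case (Cons b w)
  show ?case
  proof (cases "upper x")
    case True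
    show ?thesis
    proof (cases b)
      case b: True
      then show ?thesis
        using Cons expansion_upper[OF True] by simp
    next
      case False
      then show ?thesis
        using True by (simp add: upper_def threshold_one)
    qed
  next
    case False
    moreover have "\<not> b"
      using Cons.prems expansion_lower[OF False] expansion_le_one[of "x \<oplus> x"] dyadic_pos[of w]
      by (cases b) auto
    ultimately show ?thesis
      using Cons expansion_lower[OF False] by simp
  qed
qed

section \<open>Semi-states as infima of morphisms\<close>

lemma semi_state_filter:
  assumes "mv_algebra A" "semi_state A t"
  shows "mv_filter A {x \<in> carrier A. t x = 1}"
proof -
  interpret mv_algebra A by fact
  have le: "t x \<le> 1" if "x \<in> carrier A" for x
    using assms(2) that by (auto simp: semi_state_def Pi_iff)
  have mono: "t x \<le> t y" if "x \<in> carrier A" "y \<in> carrier A" "x \<preceq>\<^bsub>A\<^esub> y" for x y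
    using assms(2) that by (auto simp: semi_state_def)
  show ?thesis
  proof (rule mv_filterI)
    show "y \<in> {x \<in> carrier A. t x = 1}"
      if "x \<in> {x \<in> carrier A. t x = 1}" "y \<in> carrier A" "x \<preceq>\<^bsub>A\<^esub> y" for x y
      using that mono[of x y] le[of y] by simp
  qed (use assms(2) in \<open>auto simp: semi_state_def\<close>)
qed

lemma mv_hom_compose:
  assumes "f \<in> mv_hom A B" "g \<in> mv_hom B C"
  shows "(\<lambda>x. g (f x)) \<in> mv_hom A C"
  using assms by (auto simp: mv_hom_def Pi_iff)

lemma mv_morphism_below_threshold:
  assumes A: "mv_algebra A" and F: "mv_filter A F"
    and x: "x \<in> carrier A" "threshold A w x \<notin> F"
  obtains s where "s \<in> mv_hom A standard_mv" "\<And>y. y \<in> F \<Longrightarrow> s y = 1" "s x \<le> dyadic w"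
proof -
  interpret mv_algebra A by fact
  obtain C :: "'a mv_algebra" and h where C: "mv_chain C" and h: "h \<in> mv_hom A C"
    and hF: "\<And>y. y \<in> F \<Longrightarrow> h y = \<one>\<^bsub>C\<^esub>" and hz: "h (threshold A w x) \<noteq> \<one>\<^bsub>C\<^esub>"
    using filter_separation_by_chain[OF A F threshold_closed[OF x(1)] x(2)] by blast
  interpret C: mv_chain C by fact
  have "h x \<in> carrier C"
    using h x(1) by (auto simp: mv_hom_def)
  then have "C.expansion (h x) \<le> dyadic w"
    using C.threshold_of_expansion[of "h x" w] hz threshold_hom[OF A h x(1), of w] by fastforce
  moreover have "(\<lambda>y. C.expansion (h y)) \<in> mv_hom A standard_mv"
    using h C.expansion_hom by (rule mv_hom_compose)
  ultimately show thesis
    using that[of "\<lambda>y. C.expansion (h y)"] hF C.expansion_one by simp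
qed

theorem proposition3:
  fixes A :: "('a, 'b) mv_algebra_scheme" and t :: "'a \<Rightarrow> real"
  assumes "mv_algebra A"
    and "semi_state A t"
  shows "\<forall>x\<in>carrier A. t x = unit_Inf {s x | s. s \<in> mv_morphisms_above A t}"
proof
  fix x assume x: "x \<in> carrier A"
  interpret mv_algebra A by fact
  have t_unit: "t y \<in> {0..1}" if "y \<in> carrier A" for y
    using assms(2) that by (auto simp: semi_state_def)
  define F where "F = {y \<in> carrier A. t y = 1}"
  have F: "mv_filter A F"
    unfolding F_def using assms by (rule semi_state_filter)
  have threshold_F: "threshold A w y \<in> F \<longleftrightarrow> dyadic w \<le> t y" if "y \<in> carrier A" for w y
    using that t_unit threshold_semi_state[OF assms that, of w]
    by (simp add: F_def threshold_standard_mv)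
  \<comment> \<open>The thresholds recover \<open>t\<close> from \<open>F\<close>, so a morphism need only be 1 on \<open>F\<close>.\<close>
  have above: "s \<in> mv_morphisms_above A t"
    if s: "s \<in> mv_hom A standard_mv" "\<And>y. y \<in> F \<Longrightarrow> s y = 1" for s
  proof -
    have "t y \<le> s y" if y: "y \<in> carrier A" for y
    proof (rule ccontr)
      assume "\<not> t y \<le> s y"
      moreover have s_unit: "s y \<in> {0..1}"
        using s(1) y by (auto simp: mv_hom_def)
      ultimately obtain w where w: "s y < dyadic w" "dyadic w \<le> t y"
        using dyadic_dense[of "s y" "t y"] t_unit[OF y] by auto
      then have "threshold standard_mv w (s y) = 1"
        using s(2) threshold_F[OF y] threshold_hom[OF assms(1) s(1) y, of w] by simp
      then show False
        using w threshold_standard_mv[OF s_unit] by simp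
    qed
    with s(1) show ?thesis
      by (simp add: mv_morphisms_above_def)
  qed
  have values_unit: "{s x | s. s \<in> mv_morphisms_above A t} \<subseteq> {0..1}"
    using x by (auto simp: mv_morphisms_above_def mv_hom_def Pi_iff)
  have "u \<le> t x" if u: "u \<in> {0..1}" "\<forall>a\<in>{s x | s. s \<in> mv_morphisms_above A t}. u \<le> a" for u
  proof (rule ccontr)
    assume "\<not> u \<le> t x"
    \<comment> \<open>The midpoint makes the dyadic number strictly smaller than \<open>u\<close>.\<close>
    then obtain w where w: "t x < dyadic w" "dyadic w \<le> (t x + u) / 2"
      using dyadic_dense[of "t x" "(t x + u) / 2"] t_unit[OF x] u(1) by auto
    then obtain s where s: "s \<in> mv_hom A standard_mv" "\<And>y. y \<in> F \<Longrightarrow> s y = 1" "s x \<le> dyadic w"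
      using mv_morphism_below_threshold[OF assms(1) F x, of w] threshold_F[OF x, of w] by auto
    then have "u \<le> s x"
      using u(2) above by blast
    then show False
      using w s(3) \<open>\<not> u \<le> t x\<close> by simp
  qed
  then show "t x = unit_Inf {s x | s. s \<in> mv_morphisms_above A t}"
    using unit_Inf_eq_iff[OF values_unit] t_unit[OF x] x by (auto simp: mv_morphisms_above_def)
qed

end
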